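(* Let $d\ge1$ and, for $k=1,2$, let $U^{(k)}\sim\mathcal N_d(0,\Sigma_k)$, $Z_i^{(k)}:=\exp(U_i^{(k)}-\frac12(\Sigma_k)_{ii})$, $i=1,\dots,d$, and let $F_k=e^{-V_k}$ be the Brown--Resnick/Hüsler--Reiss distribution function with $V_k(x)=\mathbb{E}\{\max_{1\le i\le d}Z_i^{(k)}/x_i\}$, $x\in(0,\infty)^d$. Let $$\gamma_{ij}^{(k)}:=\operatorname{Var}(U_i^{(k)}-U_j^{(k)}),\qquad\lambda_{ij}^{(k)}:=\sqrt{\gamma_{ij}^{(k)}},$$ and assume $\lambda_{ij}^{(k)}>0$ for $i\ne j$, $k=1,2$. For $i\in\{1,\dots,d\}$ and $j,l\in I_i:=\{1,\dots,d\}\setminus\{i\}$ put $$q_j^{(k,i)}(x)=\frac{\lambda_{ij}^{(k)}}2+\frac1{\lambda_{ij}^{(k)}}\log\frac{x_j}{x_i},\qquad(R^{(k,i)})_{jl}=\frac{(\lambda_{ij}^{(k)})^2+(\lambda_{il}^{(k)})^2-(\lambda_{jl}^{(k)})^2}{2\lambda_{ij}^{(k)}\lambda_{il}^{(k)}}.$$ Then $$\mathrm d_K(F_1,F_2)\le\omega(\Delta_{\mathrm{HR}})\le\frac{\Delta_{\mathrm{HR}}}e,$$ where $$\Delta_{\mathrm{HR}}:=\sup_{\substack{x\in(0,\infty)^d\\ \min_ix_i=1}}\left|\sum_{i=1}^d\frac1{x_i}\left[\Phi_{d-1}\bigl(q^{(1,i)}(x);R^{(1,i)}\bigr)-\Ph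i_{d-1}\bigl(q^{(2,i)}(x);R^{(2,i)}\bigr)\right]\right|.$$
   Context: $F_k(x)=e^{-V_k(x)}$ for $x\in(0,\infty)^d$ and $F_k(x)=0$ if some coordinate of $x$ is non-positive. Kolmogorov distance: $\mathrm d_K(F_1,F_2)=\sup_{x\in\mathbb{R}^d}|F_1(x)-F_2(x)|$. The function $\omega:[0,\infty)\to[0,\infty)$ is $\omega(0)=0$ and $\omega(t)=\frac{t}{1+t}(1+t)^{-1/t}$ for $t>0$. For $m\ge1$, $q\in\mathbb{R}^m$ and a (possibly singular) positive semidefinite correlation matrix $R$, $\Phi_m(q;R):=\mathbb{P}\{Y_r\le q_r,\ r=1,\dots,m\}$ with $Y\sim\mathcal N_m(0,R)$; $\Phi_0:=1$. The vector $q^{(k,i)}(x)=(q_j^{(k,i)}(x))_{j\in I_i}$ and the matrix $R^{(k,i)}$ are indexed by $I_i$ listed in increasing order; note $\lambda_{ii}^{(k)}=0$, and $R^{(k,i)}$ is a correlation matrix. *)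

theory Defs
  imports "HOL-Probability.Probability"
begin

text \<open>The univariate normal law with mean \<open>m\<close> and variance \<open>v \<ge> 0\<close>; zero variance gives the
  point mass at \<open>m\<close>.\<close>

definition normal_law :: "real \<Rightarrow> real \<Rightarrow> real measure" where
  "normal_law m v =
     (if v = 0 then return borel m
      else density lborel (\<lambda>x. ennreal (normal_density m (sqrt v) x)))"

definition psd_matrix_on :: "'i set \<Rightarrow> ('i \<Rightarrow> 'i \<Rightarrow> real) \<Rightarrow> bool" where
  "psd_matrix_on I R \<longleftrightarrow>
     (\<forall>i\<in>I. \<forall>j\<in>I. R i j = R j i) \<and>
     (\<forall>a. 0 \<le> (\<Sum>i\<in>I. \<Sum>j\<in>I. a i * a j * R i j))"

text \<open>\<open>(X\<^sub>i)\<close>, with \<open>i\<close> ranging over a finite index set \<open>I\<close>, is a centred Gaussian vector with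
  (possibly singular) covariance matrix \<open>R\<close>: every linear combination \<open>\<Sum> a\<^sub>i X\<^sub>i\<close> has the law
  \<open>N(0, a\<^sup>T R a)\<close>.\<close>

definition centered_gaussian ::
  "'a measure \<Rightarrow> 'i set \<Rightarrow> ('i \<Rightarrow> 'a \<Rightarrow> real) \<Rightarrow> ('i \<Rightarrow> 'i \<Rightarrow> real) \<Rightarrow> bool" where
  "centered_gaussian M I X R \<longleftrightarrow>
     prob_space M \<and> finite I \<and> psd_matrix_on I R \<and>
     (\<forall>i\<in>I. X i \<in> borel_measurable M) \<and>
     (\<forall>a. distr M borel (\<lambda>\<omega>. \<Sum>i\<in>I. a i * X i \<omega>) =
            normal_law 0 (\<Sum>i\<in>I. \<Sum>j\<in>I. a i * a j * R i j))"

text \<open>The law \<open>N(0, R)\<close> on \<open>\<real>\<^sup>I\<close>. For finite \<open>I\<close> and positive semidefinite \<open>R\<close> it exists, and it is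
  unique because the laws of all linear functionals determine a law on \<open>\<real>\<^sup>I\<close> (Cramer-Wold).\<close>

definition mvn_law :: "'i set \<Rightarrow> ('i \<Rightarrow> 'i \<Rightarrow> real) \<Rightarrow> ('i \<Rightarrow> real) measure" where
  "mvn_law I R =
     (THE N. sets N = sets (PiM I (\<lambda>_. borel)) \<and> centered_gaussian N I (\<lambda>i y. y i) R)"

text \<open>\<open>\<Phi>\<^sub>m(q; R)\<close> for coordinates indexed by an arbitrary finite set \<open>I\<close> with \<open>m\<close> elements instead
  of \<open>{1, \<dots>, m}\<close>; the value does not depend on how \<open>I\<close> is enumerated.\<close>

definition Phi :: "'i set \<Rightarrow> ('i \<Rightarrow> real) \<Rightarrow> ('i \<Rightarrow> 'i \<Rightarrow> real) \<Rightarrow> real" where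
  "Phi I q R =
     (if I = {} then 1
      else measure (mvn_law I R) {y \<in> space (mvn_law I R). \<forall>r\<in>I. y r \<le> q r})"

definition HR_Z :: "real^'n^'n \<Rightarrow> ('a \<Rightarrow> real^'n) \<Rightarrow> 'n \<Rightarrow> 'a \<Rightarrow> real" where
  "HR_Z S U i \<omega> = exp (U \<omega> $ i - S $ i $ i / 2)"

definition HR_V :: "'a measure \<Rightarrow> real^'n^'n \<Rightarrow> ('a \<Rightarrow> real^'n) \<Rightarrow> real^'n \<Rightarrow> real" where
  "HR_V M S U x = prob_space.expectation M (\<lambda>\<omega>. Max (range (\<lambda>i. HR_Z S U i \<omega> / x $ i)))"

definition HR_F :: "'a measure \<Rightarrow> real^'n^'n \<Rightarrow> ('a \<Rightarrow> real^'n) \<Rightarrow> real^'n \<Rightarrow> real" where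
  "HR_F M S U x = (if \<forall>i. x $ i > 0 then exp (- HR_V M S U x) else 0)"

definition kolmogorov_dist :: "(real^'n \<Rightarrow> real) \<Rightarrow> (real^'n \<Rightarrow> real) \<Rightarrow> real" where
  "kolmogorov_dist F G = (SUP x. \<bar>F x - G x\<bar>)"

definition HR_gamma :: "'a measure \<Rightarrow> ('a \<Rightarrow> real^'n) \<Rightarrow> 'n \<Rightarrow> 'n \<Rightarrow> real" where
  "HR_gamma M U i j = prob_space.variance M (\<lambda>\<omega>. U \<omega> $ i - U \<omega> $ j)"

definition HR_lambda :: "'a measure \<Rightarrow> ('a \<Rightarrow> real^'n) \<Rightarrow> 'n \<Rightarrow> 'n \<Rightarrow> real" where
  "HR_lambda M U i j = sqrt (HR_gamma M U i j)"

definition HR_q :: "('n \<Rightarrow> 'n \<Rightarrow> real) \<Rightarrow> 'n \<Rightarrow> real^'n \<Rightarrow> 'n \<Rightarrow> real" where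
  "HR_q L i x j = L i j / 2 + 1 / L i j * ln (x $ j / x $ i)"

definition HR_R :: "('n \<Rightarrow> 'n \<Rightarrow> real) \<Rightarrow> 'n \<Rightarrow> 'n \<Rightarrow> 'n \<Rightarrow> real" where
  "HR_R L i j l = ((L i j)\<^sup>2 + (L i l)\<^sup>2 - (L j l)\<^sup>2) / (2 * L i j * L i l)"

text \<open>Every \<open>x\<close> in the index set has all coordinates at least 1, so the absolute values are bounded
  by the dimension and the real supremum is a genuine one.\<close>

definition Delta_HR :: "('n::finite \<Rightarrow> 'n \<Rightarrow> real) \<Rightarrow> ('n \<Rightarrow> 'n \<Rightarrow> real) \<Rightarrow> real" where
  "Delta_HR L1 L2 =
     (SUP x \<in> {x :: real^'n. (\<forall>i. x $ i > 0) \<and> Min (range (\<lambda>i. x $ i)) = 1}.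
        \<bar>\<Sum>i\<in>UNIV. 1 / x $ i *
           (Phi (UNIV - {i}) (HR_q L1 i x) (HR_R L1 i) -
            Phi (UNIV - {i}) (HR_q L2 i x) (HR_R L2 i))\<bar>)"

text \<open>Only meant for arguments \<open>t \<ge> 0\<close>.\<close>

definition omega :: "real \<Rightarrow> real" where
  "omega t = (if t = 0 then 0 else t / (1 + t) * (1 + t) powr (- 1 / t))"

end

theory Submission
  imports Defs
begin

text \<open>The argument has three ingredients.

  First, \<open>V\<close> is written through normal probabilities (\<open>HR_V_eq_sum_Phi\<close>). Almost surely exactly one index
  \<open>k\<close> attains the maximum of \<open>Z\<^sub>j / x\<^sub>j\<close>, since the differences \<open>U\<^sub>i - U\<^sub>j\<close> have densities. The contribution of
  \<open>k\<close> to \<open>V x\<close> is \<open>1 / x\<^sub>k\<close> times the probability that \<open>k\<close> attains the maximum under the measure with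
  density \<open>Z\<^sub>k\<close>. By the Cameron-Martin formula (\<open>centered_gaussian_tilted\<close>) this change of measure only shifts
  the mean of \<open>U\<close> by the \<open>k\<close>-th column of \<open>S\<close>, so the normalized differences of \<open>U\<close> with \<open>U\<^sub>k\<close> are centred
  Gaussian with correlation matrix \<open>HR_R\<close> after recentring, and the event reads \<open>\<le> HR_q\<close> in every component.
  Hence the supremum \<open>\<Delta>\<close> defining \<open>Delta_HR\<close> is that of \<open>\<bar>V\<^sub>1 x - V\<^sub>2 x\<bar>\<close> over \<open>x\<close> with minimal coordinate one.

  Second, \<open>V\<close> is homogeneous of order \<open>-1\<close> and \<open>V x \<ge> 1\<close> when the minimal coordinate of \<open>x\<close> is one. So at a
  point with minimal coordinate \<open>r\<close> the two distribution functions are \<open>exp (-a / r)\<close> and \<open>exp (-b / r)\<close>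
  with \<open>a, b \<ge> 1\<close> and \<open>\<bar>a - b\<bar> \<le> \<Delta>\<close>. Third, \<open>omega t\<close> is the maximum of \<open>exp (-u) - exp (-(1 + t)u)\<close> over
  \<open>u \<ge> 0\<close> (\<open>exp_diff_le_omega\<close>, \<open>omega_attained\<close>), which gives the bound at each point and the monotonicity of
  \<open>omega\<close>.

  That \<open>mvn_law\<close> is the law of any Gaussian vector with the given covariance, and that uncorrelated Gaussian
  variables are independent, both rest on the Cramer-Wold theorem (\<open>Cramer_Wold\<close>), which is derived from
  Levy's one-dimensional uniqueness theorem.\<close>

section \<open>The function \<open>\<omega>\<close>\<close>

text \<open>For \<open>t \<ge> 0\<close>, \<open>omega t\<close> is the maximum over \<open>u \<ge> 0\<close> of \<open>exp (-u) - exp (-(1 + t)u)\<close>. With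
  \<open>w = exp (-u)\<close> this is the maximum of \<open>w - w powr (1 + t)\<close>, taken for \<open>t > 0\<close> at \<open>c = (1 + t) powr (-1 / t)\<close>; the
  upper bound is the weighted arithmetic-geometric mean inequality for \<open>w / c\<close>.\<close>

lemma exp_diff_le_omega:
  assumes "0 \<le> t"
  shows "exp (- u) - exp (- ((1 + t) * u)) \<le> omega t"
proof (cases "t = 0")
  case False
  with assms have t: "0 < t" by simp
  define c where "c = (1 + t) powr (- 1 / t)"
  have c: "0 < c" using t by (simp add: c_def)
  have c1: "c powr (1 + t) = c / (1 + t)"
  proof -
    have "c powr (1 + t) = (1 + t) powr ((- 1 / t) + (- 1))"
      using t by (simp add: c_def powr_powr add_divide_distrib diff_divide_distrib ring_distribs)
    also have "\<dots> = c * (1 + t) powr (- 1)"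
      unfolding c_def by (rule powr_add)
    also have "(1 + t) powr (- 1) = 1 / (1 + t)"
      using t by (simp add: powr_minus_divide)
    finally show ?thesis by simp
  qed
  define w where "w = exp (- u)"
  have w: "0 < w" "exp (- ((1 + t) * u)) = w powr (1 + t)"
    by (auto simp: w_def powr_def)
  have "((w / c) powr (1 + t)) powr (1 / (1 + t)) * 1 powr (t / (1 + t))
      \<le> 1 / (1 + t) * (w / c) powr (1 + t) + t / (1 + t) * 1"
    by (rule Youngs_inequality_0) (use t w c in \<open>auto simp: field_simps\<close>)
  then have "w / c \<le> ((w / c) powr (1 + t) + t) / (1 + t)"
    using t w c by (simp add: powr_powr add_divide_distrib)
  also have "(w / c) powr (1 + t) = w powr (1 + t) * (1 + t) / c"
    using w c c1 t by (simp add: powr_divide)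
  also have "(w powr (1 + t) * (1 + t) / c + t) / (1 + t) = (w powr (1 + t) + c * t / (1 + t)) / c"
    using t c by (simp add: field_simps)
  finally have "w \<le> w powr (1 + t) + c * t / (1 + t)"
    using c by (simp add: divide_le_cancel)
  then show ?thesis
    using t unfolding w(2) omega_def w_def[symmetric] c_def[symmetric] by (simp add: mult.commute)
qed (simp add: omega_def)

lemma omega_attained:
  assumes "0 < t"
  obtains u where "0 < u" "omega t = exp (- u) - exp (- ((1 + t) * u))"
proof
  show "0 < ln (1 + t) / t" using assms by simp
  have "exp (- ((1 + t) * (ln (1 + t) / t))) = exp (- (ln (1 + t) / t) + - ln (1 + t))"
    using assms by (simp add: field_simps)
  also have "\<dots> = exp (- (ln (1 + t) / t)) / (1 + t)"
    unfolding exp_add using assms by (simp add: exp_minus field_simps)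
  finally show "omega t = exp (- (ln (1 + t) / t)) - exp (- ((1 + t) * (ln (1 + t) / t)))"
    using assms by (simp add: omega_def powr_def field_simps)
qed

text \<open>Monotonicity needs no derivative: a maximizer for \<open>s\<close> is tested in the variational bound for \<open>t\<close>.\<close>

lemma omega_mono:
  assumes "0 \<le> s" "s \<le> t"
  shows "omega s \<le> omega t"
proof (cases "s = 0")
  case True
  then show ?thesis
    using assms by (auto simp: omega_def)
next
  case False
  then obtain u where u: "0 < u" "omega s = exp (- u) - exp (- ((1 + s) * u))"
    using omega_attained[of s] assms by auto
  have "omega s \<le> exp (- u) - exp (- ((1 + t) * u))"
    unfolding u(2) using u(1) assms by (simp add: mult_right_mono)
  also have "\<dots> \<le> omega t"
    using assms by (intro exp_diff_le_omega) auto
  finally show ?thesis .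
qed

lemma omega_le_divide_exp1:
  assumes "0 \<le> t"
  shows "omega t \<le> t / exp 1"
proof (cases "t = 0")
  case False
  with assms have t: "0 < t" by simp
  have "- ln (1 + t) = ln (1 / (1 + t))" using t by (simp add: ln_div)
  also have "\<dots> \<le> 1 / (1 + t) - 1" using t by (intro ln_le_minus_one) auto
  also have "\<dots> = - (t / (1 + t))" using t by (simp add: field_simps)
  finally have "t / (1 + t) \<le> ln (1 + t)" by simp
  then have "1 \<le> ln (1 + t) + ln (1 + t) / t"
    using t by (simp add: field_simps)
  then have "exp (- (ln (1 + t) / t)) * exp (- ln (1 + t)) \<le> exp (- 1)"
    unfolding exp_add[symmetric] by simp
  then have "exp (- (ln (1 + t) / t)) / (1 + t) \<le> 1 / exp 1"
    using t by (simp add: exp_minus field_simps)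
  from mult_left_mono[OF this assms] show ?thesis
    using t by (simp add: omega_def powr_def)
qed (simp add: omega_def)

section \<open>Univariate normal laws\<close>

text \<open>Degenerate and non-degenerate normal laws are treated together from here on, as affine images of
  the standard normal law.\<close>

lemma normal_law_eq_distr:
  assumes "0 \<le> v"
  shows "normal_law m v = distr std_normal_distribution borel (\<lambda>x. m + sqrt v * x)"
proof -
  interpret real_distribution std_normal_distribution by (rule real_dist_normal_dist)
  show ?thesis
  proof (cases "v = 0")
    case False
    have "distributed std_normal_distribution lborel (\<lambda>x. x) std_normal_density"
      by (simp add: distributed_def distr_id2 cong: distr_cong)
    from normal_density_affine[OF this, of "sqrt v" m]
    have "distr std_normal_distribution lborel (\<lambda>x. m + sqrt v * x) = density lborel (normal_density m (sqrt v))"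
      using False assms by (simp add: distributed_def)
    then show ?thesis
      using False by (simp add: normal_law_def cong: distr_cong)
  qed (simp add: normal_law_def)
qed

lemma real_distribution_normal_law:
  assumes "0 \<le> v"
  shows "real_distribution (normal_law m v)"
proof -
  interpret real_distribution std_normal_distribution by (rule real_dist_normal_dist)
  show ?thesis
    unfolding normal_law_eq_distr[OF assms] by (intro real_distribution_distr) auto
qed

lemma char_normal_law:
  assumes "0 \<le> v"
  shows "char (normal_law m v) t = iexp (t * m) * exp (- (t\<^sup>2 * v / 2))"
proof -
  have "char (normal_law m v) t = (CLINT x|std_normal_distribution. iexp (t * m) * iexp (t * sqrt v * x))"
    by (simp add: normal_law_eq_distr[OF assms] char_def integral_distr ring_distribs exp_add mult_ac)
  also have "\<dots> = iexp (t * m) * char std_normal_distribution (t * sqrt v)"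
    unfolding char_def by simp
  finally show ?thesis
    using assms by (simp add: char_std_normal_distribution power_mult_distrib)
qed

lemma
  assumes "0 \<le> v"
  shows integral_normal_law_first: "(\<integral>x. x \<partial>normal_law 0 v) = 0"
    and integral_normal_law_second: "(\<integral>x. x\<^sup>2 \<partial>normal_law 0 v) = v"
  using assms std_normal_distribution_even_moments(1)[of 1]
    integral_std_normal_distribution_moment_odd[of 1]
  by (simp_all add: normal_law_eq_distr integral_distr power_mult_distrib fact_numeral)

lemma AE_normal_law_neq:
  assumes "0 < v"
  shows "AE x in normal_law m v. x \<noteq> c"
proof -
  have "AE x in density lborel (\<lambda>x. ennreal (normal_density m (sqrt v) x)). x \<noteq> c"
  proof (subst AE_density)
    show "AE x in lborel. 0 < ennreal (normal_density m (sqrt v) x) \<longrightarrow> x \<noteq> c"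
      using AE_lborel_singleton[of c] by eventually_elim simp
  qed simp
  moreover have "normal_law m v = density lborel (\<lambda>x. ennreal (normal_density m (sqrt v) x))"
    using assms unfolding normal_law_def by simp
  ultimately show ?thesis
    by (rule ssubst[rotated])
qed

lemma density_exp_std_normal:
  "density std_normal_distribution (\<lambda>x. ennreal (exp (s * x - s\<^sup>2 / 2))) = normal_law s 1"
proof -
  have "exp (s * x - s\<^sup>2 / 2) * std_normal_density x = normal_density s 1 x" for x
    by (simp add: normal_density_def exp_add[symmetric] power2_eq_square field_simps)
  then show ?thesis
    by (simp add: density_density_eq normal_law_def ennreal_mult[symmetric] mult.commute)
qed

text \<open>The one-dimensional Cameron-Martin formula: weighting \<open>N(0, v)\<close> with the exponential of mean one
  shifts the mean by \<open>v\<close>.\<close>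

lemma density_exp_normal_law:
  assumes "0 \<le> v"
  shows "density (normal_law 0 v) (\<lambda>x. ennreal (exp (x - v / 2))) = normal_law v v"
proof -
  have "density (normal_law 0 v) (\<lambda>x. ennreal (exp (x - v / 2))) =
      distr (density std_normal_distribution (\<lambda>x. ennreal (exp (sqrt v * x - (sqrt v)\<^sup>2 / 2)))) borel (\<lambda>x. sqrt v * x)"
    using assms by (simp add: normal_law_eq_distr density_distr)
  also have "\<dots> = distr (distr std_normal_distribution borel (\<lambda>x. sqrt v + x)) borel (\<lambda>x. sqrt v * x)"
    unfolding density_exp_std_normal by (simp add: normal_law_eq_distr)
  also have "\<dots> = normal_law v v"
    using assms by (simp add: normal_law_eq_distr distr_distr comp_def ring_distribs)
  finally show ?thesis .
qed

section \<open>Laws on \<open>\<real>\<^sup>I\<close> are determined by their one-dimensional projections\<close>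

lemma integral_scaleR_iexp:
  fixes f X :: "'a \<Rightarrow> real"
  assumes "finite_measure M" and [measurable]: "f \<in> borel_measurable M" "X \<in> borel_measurable M"
    and bound: "\<And>x. \<bar>f x\<bar> \<le> B"
  shows "(CLINT x|M. f x *\<^sub>R iexp (X x)) = Complex (\<integral>x. f x * cos (X x) \<partial>M) (\<integral>x. f x * sin (X x) \<partial>M)"
proof -
  interpret finite_measure M by fact
  have int: "integrable M (\<lambda>x. f x *\<^sub>R iexp (X x))"
    by (rule integrable_const_bound[of _ B]) (auto simp: bound norm_mult)
  show ?thesis
    by (simp add: complex_eq_iff integral_Re[OF int, symmetric] integral_Im[OF int, symmetric] Re_exp Im_exp)
qed

text \<open>The law of \<open>X\<close> under the probability measure obtained from \<open>M\<close> by normalizing the bounded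
  nonnegative weight \<open>f\<close>. It is meaningful only when \<open>f\<close> has positive integral.\<close>

definition weighted_law :: "'a measure \<Rightarrow> ('a \<Rightarrow> real) \<Rightarrow> ('a \<Rightarrow> real) \<Rightarrow> real measure" where
  "weighted_law M f X = distr (density M (\<lambda>x. ennreal (f x / (\<integral>x. f x \<partial>M)))) borel X"

lemma
  fixes f X :: "'a \<Rightarrow> real"
  assumes "finite_measure M" and [measurable]: "f \<in> borel_measurable M" "X \<in> borel_measurable M"
    and f: "\<And>x. 0 \<le> f x" "\<And>x. f x \<le> B" and pos: "0 < (\<integral>x. f x \<partial>M)"
  shows real_distribution_weighted_law: "real_distribution (weighted_law M f X)"
    and char_weighted_law: "char (weighted_law M f X) t =
      Complex (\<integral>x. f x * cos (t * X x) \<partial>M) (\<integral>x. f x * sin (t * X x) \<partial>M) / (\<integral>x. f x \<partial>M)"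
    and measure_weighted_law: "A \<in> sets borel \<Longrightarrow>
      measure (weighted_law M f X) A = (\<integral>x. f x * indicator A (X x) \<partial>M) / (\<integral>x. f x \<partial>M)"
proof -
  interpret finite_measure M by fact
  let ?m = "\<integral>x. f x \<partial>M"
  have int: "integrable M f"
    by (rule integrable_const_bound[of _ B]) (auto simp: f)
  have "(\<integral>\<^sup>+x. ennreal (f x / ?m) \<partial>M) = ennreal (\<integral>x. f x / ?m \<partial>M)"
    using f(1) pos int by (intro nn_integral_eq_integral) auto
  then have "emeasure (density M (\<lambda>x. ennreal (f x / ?m))) (space M) = 1"
    using pos by (simp add: emeasure_density cong: nn_integral_cong_simp)
  then interpret D: prob_space "density M (\<lambda>x. ennreal (f x / ?m))"
    by (intro prob_spaceI) simp
  show "real_distribution (weighted_law M f X)"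
    unfolding weighted_law_def by (intro D.real_distribution_distr) simp
  have "char (weighted_law M f X) t = (CLINT x|M. (f x / ?m) *\<^sub>R iexp (t * X x))"
    unfolding weighted_law_def char_def using f(1) pos
    by (simp add: integral_distr integral_density)
  also have "\<dots> = (CLINT x|M. f x *\<^sub>R iexp (t * X x)) / ?m"
    by (simp add: scaleR_conv_of_real)
  finally show "char (weighted_law M f X) t =
      Complex (\<integral>x. f x * cos (t * X x) \<partial>M) (\<integral>x. f x * sin (t * X x) \<partial>M) / ?m"
    using f by (subst (asm) integral_scaleR_iexp[where B = B]) (auto simp: assms(1))
  assume A[measurable]: "A \<in> sets borel"
  have "measure (weighted_law M f X) A = (\<integral>x. indicator A x \<partial>weighted_law M f X)"
    by (simp add: weighted_law_def)
  also have "\<dots> = (\<integral>x. f x / ?m * indicator A (X x) \<partial>M)"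
    unfolding weighted_law_def using f(1) pos
    by (subst integral_distr, simp, simp, subst integral_density) auto
  also have "\<dots> = (\<integral>x. f x * indicator A (X x) \<partial>M) / ?m"
    by simp
  finally show "measure (weighted_law M f X) A = (\<integral>x. f x * indicator A (X x) \<partial>M) / ?m" .
qed

text \<open>Levy's uniqueness theorem for the (unnormalized) laws of \<open>X\<close> and \<open>Y\<close> weighted by \<open>f\<close> and \<open>g\<close>. The
  Fourier transforms are compared through cosines with an arbitrary phase \<open>c\<close>, which covers real and
  imaginary part at once.\<close>

lemma weighted_Levy_uniqueness:
  fixes f X :: "'a \<Rightarrow> real" and g Y :: "'b \<Rightarrow> real"
  assumes M: "finite_measure M" "f \<in> borel_measurable M" "X \<in> borel_measurable M"
    and N: "finite_measure N" "g \<in> borel_measurable N" "Y \<in> borel_measurable N"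
    and f: "\<And>x. 0 \<le> f x" "\<And>x. f x \<le> B" and g: "\<And>x. 0 \<le> g x" "\<And>x. g x \<le> B"
    and eq: "\<And>t c. (\<integral>x. f x * cos (t * X x + c) \<partial>M) = (\<integral>x. g x * cos (t * Y x + c) \<partial>N)"
    and A: "A \<in> sets borel"
  shows "(\<integral>x. f x * indicator A (X x) \<partial>M) = (\<integral>x. g x * indicator A (Y x) \<partial>N)"
proof -
  interpret M: finite_measure M by fact
  interpret N: finite_measure N by fact
  note [measurable] = M(2,3) N(2,3) A
  have int: "integrable M f" "integrable N g"
    by (auto intro!: M.integrable_const_bound[of _ B] N.integrable_const_bound[of _ B] simp: f g)
  have m: "(\<integral>x. f x \<partial>M) = (\<integral>x. g x \<partial>N)"
    using eq[of 0 0] by simp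
  show ?thesis
  proof (cases "(\<integral>x. f x \<partial>M) = 0")
    case True
    have "AE x in M. f x = 0"
      using True f int by (subst (asm) integral_nonneg_eq_0_iff_AE) auto
    moreover have "AE x in N. g x = 0"
      using True[unfolded m] g int by (subst (asm) integral_nonneg_eq_0_iff_AE) auto
    ultimately have "(\<integral>x. f x * indicator A (X x) \<partial>M) = (\<integral>x. 0 \<partial>M)"
      "(\<integral>x. g x * indicator A (Y x) \<partial>N) = (\<integral>x. 0 \<partial>N)"
      by (auto intro!: integral_eq_zero_AE)
    then show ?thesis by simp
  next
    case False
    moreover have "0 \<le> (\<integral>x. f x \<partial>M)" using f by simp
    ultimately have pos: "0 < (\<integral>x. f x \<partial>M)" "0 < (\<integral>x. g x \<partial>N)"
      using m by auto
    have sin_cos: "sin x = cos (x + - (pi / 2))" for x :: real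
      by (simp add: cos_diff)
    have "char (weighted_law M f X) t = char (weighted_law N g Y) t" for t
      unfolding char_weighted_law[OF M f pos(1)] char_weighted_law[OF N g pos(2)]
      using eq[of t 0] eq[of t "- (pi / 2)"] m by (simp only: sin_cos) simp
    then have "weighted_law M f X = weighted_law N g Y"
      by (intro Levy_uniqueness real_distribution_weighted_law[OF M f pos(1)]
        real_distribution_weighted_law[OF N g pos(2)]) auto
    then show ?thesis
      using measure_weighted_law[OF M f pos(1) A] measure_weighted_law[OF N g pos(2) A] m pos
      by simp
  qed
qed

text \<open>The induction behind the Cramer-Wold theorem replaces Fourier data by indicators, one coordinate at
  a time. If \<open>P\<close> is the indicator of the rectangle treated so far, then the nonnegative weight
  \<open>P (1 + cos (b \<bullet> X + c))\<close> has, by the product formula for cosines, a Fourier transform in the direction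
  of the next coordinate that the induction hypothesis determines, so the one-dimensional theorem
  applies to that coordinate.\<close>

lemma integral_rectangle_cos_eq:
  fixes X :: "'i \<Rightarrow> 'a \<Rightarrow> real" and Y :: "'i \<Rightarrow> 'b \<Rightarrow> real"
  assumes M: "finite_measure M" "\<And>i. i \<in> I \<Longrightarrow> X i \<in> borel_measurable M"
    and N: "finite_measure N" "\<And>i. i \<in> I \<Longrightarrow> Y i \<in> borel_measurable N"
    and I: "finite I"
    and eq: "\<And>b c. (\<integral>x. cos ((\<Sum>i\<in>I. b i * X i x) + c) \<partial>M) = (\<integral>x. cos ((\<Sum>i\<in>I. b i * Y i x) + c) \<partial>N)"
    and K: "finite K" "K \<subseteq> I" and A: "\<And>k. k \<in> K \<Longrightarrow> A k \<in> sets borel"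
  shows "(\<integral>x. (\<Prod>k\<in>K. indicator (A k) (X k x)) * cos ((\<Sum>i\<in>I. b i * X i x) + c) \<partial>M) =
    (\<integral>x. (\<Prod>k\<in>K. indicator (A k) (Y k x)) * cos ((\<Sum>i\<in>I. b i * Y i x) + c) \<partial>N)"
  using K A
proof (induction K arbitrary: b c)
  case empty
  then show ?case using eq by simp
next
  case (insert k K)
  interpret M: finite_measure M by fact
  interpret N: finite_measure N by fact
  note [measurable] = M(2) N(2)
  have k[measurable]: "k \<in> I" "A k \<in> sets borel" using insert by auto
  have [measurable]: "i \<in> K \<Longrightarrow> X i \<in> borel_measurable M" "i \<in> K \<Longrightarrow> Y i \<in> borel_measurable N"
    "i \<in> K \<Longrightarrow> A i \<in> sets borel" for i
    using insert by auto
  define P where "P x = (\<Prod>k\<in>K. indicator (A k) (X k x) :: real)" for x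
  define Q where "Q x = (\<Prod>k\<in>K. indicator (A k) (Y k x) :: real)" for x
  have [measurable]: "P \<in> borel_measurable M" "Q \<in> borel_measurable N"
    unfolding P_def Q_def by measurable
  have PQ: "0 \<le> P x" "P x \<le> 1" "0 \<le> Q y" "Q y \<le> 1" for x y
    by (auto simp: P_def Q_def intro!: prod_nonneg prod_le_1)
  let ?S = "\<lambda>b x. \<Sum>i\<in>I. b i * X i x" and ?T = "\<lambda>b x. \<Sum>i\<in>I. b i * Y i x"
  have IH: "(\<integral>x. P x * cos (?S b x + c) \<partial>M) = (\<integral>x. Q x * cos (?T b x + c) \<partial>N)" for b c
    unfolding P_def Q_def using insert by auto
  have bnd: "\<bar>P x * cos u\<bar> \<le> 1" "\<bar>Q y * cos u\<bar> \<le> 1" for x y u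
    using PQ(1,2)[of x] PQ(3,4)[of y] by (auto simp: abs_mult intro!: mult_le_one)
  have intM: "integrable M (\<lambda>x. P x * cos (?S b x + c))" for b c
    by (rule M.integrable_const_bound[of _ 1]) (auto simp: bnd)
  have intN: "integrable N (\<lambda>x. Q x * cos (?T b x + c))" for b c
    by (rule N.integrable_const_bound[of _ 1]) (auto simp: bnd)
  have split: "(\<Sum>i\<in>I. (b i + (if i = k then t else 0)) * Z i x) = (\<Sum>i\<in>I. b i * Z i x) + t * Z k x"
    for b t x and Z :: "'i \<Rightarrow> 'c \<Rightarrow> real"
    using I k by (simp add: ring_distribs sum.distrib if_distrib[of "\<lambda>u. u * _"] cong: if_cong)
  have split0: "(\<Sum>i\<in>I. (if i = k then t else 0) * Z i x) = t * Z k x"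
    for t x and Z :: "'i \<Rightarrow> 'c \<Rightarrow> real"
    using split[of "\<lambda>_. 0" t Z x] by simp
  have prod: "p * (1 + cos (s + c)) * cos (t * z + d) =
      p * cos (t * z + d) + 1/2 * (p * cos ((s + (- t) * z) + (c - d))) + 1/2 * (p * cos ((s + t * z) + (c + d)))"
    for p s c t z d :: real
    by (simp add: ring_distribs cos_times_cos algebra_simps)
  \<comment> \<open>The weight without the cosine is handled separately, so that it can be subtracted below.\<close>
  have A0: "(\<integral>x. P x * indicator (A k) (X k x) \<partial>M) = (\<integral>x. Q x * indicator (A k) (Y k x) \<partial>N)"
  proof (rule weighted_Levy_uniqueness[where B = 1])
    fix t c
    show "(\<integral>x. P x * cos (t * X k x + c) \<partial>M) = (\<integral>x. Q x * cos (t * Y k x + c) \<partial>N)"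
      using IH[of "\<lambda>i. if i = k then t else 0" c] by (simp add: split0)
  qed (use M N k PQ in auto)
  have A1: "(\<integral>x. P x * (1 + cos (?S b x + c)) * indicator (A k) (X k x) \<partial>M) =
      (\<integral>x. Q x * (1 + cos (?T b x + c)) * indicator (A k) (Y k x) \<partial>N)"
  proof (rule weighted_Levy_uniqueness[where B = 2])
    fix t d
    show "(\<integral>x. P x * (1 + cos (?S b x + c)) * cos (t * X k x + d) \<partial>M) =
        (\<integral>x. Q x * (1 + cos (?T b x + c)) * cos (t * Y k x + d) \<partial>N)"
      using intM[of "\<lambda>i. (if i = k then t else 0)" d]
        intM[of "\<lambda>i. b i + (if i = k then - t else 0)" "c - d"]
        intM[of "\<lambda>i. b i + (if i = k then t else 0)" "c + d"]
        intN[of "\<lambda>i. (if i = k then t else 0)" d]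
        intN[of "\<lambda>i. b i + (if i = k then - t else 0)" "c - d"]
        intN[of "\<lambda>i. b i + (if i = k then t else 0)" "c + d"]
        IH[of "\<lambda>i. (if i = k then t else 0)" d]
        IH[of "\<lambda>i. b i + (if i = k then - t else 0)" "c - d"]
        IH[of "\<lambda>i. b i + (if i = k then t else 0)" "c + d"]
      unfolding split split0 prod by simp
    have cos_bounds: "0 \<le> 1 + cos u" "1 + cos u \<le> 2" for u :: real
      using cos_ge_minus_one[of u] cos_le_one[of u] by linarith+
    show "0 \<le> P x * (1 + cos (?S b x + c))" "0 \<le> Q y * (1 + cos (?T b y + c))" for x y
      using PQ cos_bounds by (auto intro!: mult_nonneg_nonneg)
    show "P x * (1 + cos (?S b x + c)) \<le> 2" "Q y * (1 + cos (?T b y + c)) \<le> 2" for x y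
      using mult_mono[OF PQ(2)[of x] cos_bounds(2)[of "?S b x + c"]]
        mult_mono[OF PQ(4)[of y] cos_bounds(2)[of "?T b y + c"]] cos_bounds by auto
  qed (use M N k in auto)
  have dist: "p * (1 + u) * i = p * i + i * p * u" for p u i :: real
    by (simp add: algebra_simps)
  have bnd': "\<bar>P x * indicator (A k) z\<bar> \<le> 1" "\<bar>indicator (A k) z * P x * cos u\<bar> \<le> 1"
    "\<bar>Q y * indicator (A k) z\<bar> \<le> 1" "\<bar>indicator (A k) z * Q y * cos u\<bar> \<le> 1" for x y z u
    using PQ(1,2)[of x] PQ(3,4)[of y] bnd by (auto simp: indicator_def)
  have "integrable M (\<lambda>x. P x * indicator (A k) (X k x))"
    "integrable M (\<lambda>x. indicator (A k) (X k x) * P x * cos (?S b x + c))"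
    "integrable N (\<lambda>x. Q x * indicator (A k) (Y k x))"
    "integrable N (\<lambda>x. indicator (A k) (Y k x) * Q x * cos (?T b x + c))"
    by (auto intro!: M.integrable_const_bound[of _ 1] N.integrable_const_bound[of _ 1] AE_I2 simp only: bnd' real_norm_def) measurable
  with A0 A1 have "(\<integral>x. indicator (A k) (X k x) * P x * cos (?S b x + c) \<partial>M) =
      (\<integral>x. indicator (A k) (Y k x) * Q x * cos (?T b x + c) \<partial>N)"
    unfolding dist by simp
  then show ?case
    using insert by (simp add: P_def Q_def)
qed

lemma Cramer_Wold:
  fixes X :: "'i \<Rightarrow> 'a \<Rightarrow> real" and Y :: "'i \<Rightarrow> 'b \<Rightarrow> real"
  assumes M: "finite_measure M" "\<And>i. i \<in> I \<Longrightarrow> X i \<in> borel_measurable M"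
    and N: "finite_measure N" "\<And>i. i \<in> I \<Longrightarrow> Y i \<in> borel_measurable N"
    and I: "finite I"
    and eq: "\<And>b. (CLINT x|M. iexp (\<Sum>i\<in>I. b i * X i x)) = (CLINT x|N. iexp (\<Sum>i\<in>I. b i * Y i x))"
  shows "distr M (PiM I (\<lambda>_. borel)) (\<lambda>x. \<lambda>i\<in>I. X i x) = distr N (PiM I (\<lambda>_. borel)) (\<lambda>x. \<lambda>i\<in>I. Y i x)"
proof -
  interpret M: finite_measure M by fact
  interpret N: finite_measure N by fact
  note [measurable] = M(2) N(2)
  have "Complex (\<integral>x. cos (\<Sum>i\<in>I. b i * X i x) \<partial>M) (\<integral>x. sin (\<Sum>i\<in>I. b i * X i x) \<partial>M) =
      Complex (\<integral>x. cos (\<Sum>i\<in>I. b i * Y i x) \<partial>N) (\<integral>x. sin (\<Sum>i\<in>I. b i * Y i x) \<partial>N)" for b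
    using eq[of b] integral_scaleR_iexp[OF M(1), of "\<lambda>_. 1" "\<lambda>x. \<Sum>i\<in>I. b i * X i x" 1]
      integral_scaleR_iexp[OF N(1), of "\<lambda>_. 1" "\<lambda>x. \<Sum>i\<in>I. b i * Y i x" 1]
    by simp
  moreover have "integrable M (\<lambda>x. cos (\<Sum>i\<in>I. b i * X i x))" "integrable M (\<lambda>x. sin (\<Sum>i\<in>I. b i * X i x))"
    "integrable N (\<lambda>x. cos (\<Sum>i\<in>I. b i * Y i x))" "integrable N (\<lambda>x. sin (\<Sum>i\<in>I. b i * Y i x))" for b
    by (auto intro!: M.integrable_const_bound[of _ 1] N.integrable_const_bound[of _ 1])
  ultimately have cos: "(\<integral>x. cos ((\<Sum>i\<in>I. b i * X i x) + c) \<partial>M) = (\<integral>x. cos ((\<Sum>i\<in>I. b i * Y i x) + c) \<partial>N)" for b c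
    by (simp add: cos_add)
  let ?P = "PiM I (\<lambda>_. borel :: real measure)"
  let ?D = "distr M ?P (\<lambda>x. \<lambda>i\<in>I. X i x)" and ?E = "distr N ?P (\<lambda>x. \<lambda>i\<in>I. Y i x)"
  interpret D: finite_measure ?D by (rule M.finite_measure_distr) simp
  interpret E: finite_measure ?E by (rule N.finite_measure_distr) simp
  show ?thesis
  proof (rule measure_eqI_PiM_finite[where I = I and M = "\<lambda>_. borel" and A = "\<lambda>_. space ?P"])
    fix A assume A: "\<And>i. i \<in> I \<Longrightarrow> A i \<in> sets (borel :: real measure)"
    have PiE: "Pi\<^sub>E I A \<in> sets ?P"
      using I A by (intro sets_PiM_I_finite) auto
    have ind: "indicator (Pi\<^sub>E I A) (\<lambda>i\<in>I. z i) = (\<Prod>k\<in>I. indicator (A k) (z k) :: real)" for z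
      using I by (auto simp: indicator_def intro!: prod.neutral)
    have "measure ?D (Pi\<^sub>E I A) = (\<integral>x. indicator (Pi\<^sub>E I A) x \<partial>?D)"
      using PiE by simp
    also have "\<dots> = (\<integral>x. (\<Prod>k\<in>I. indicator (A k) (X k x)) \<partial>M)"
      using PiE by (subst integral_distr) (auto simp: ind)
    also have "\<dots> = (\<integral>x. (\<Prod>k\<in>I. indicator (A k) (Y k x)) \<partial>N)"
      using integral_rectangle_cos_eq[OF M N I cos I order_refl A, where b = "\<lambda>_. 0" and c = 0] by simp
    also have "\<dots> = (\<integral>x. indicator (Pi\<^sub>E I A) x \<partial>?E)"
      using PiE by (subst integral_distr) (auto simp: ind)
    also have "\<dots> = measure ?E (Pi\<^sub>E I A)"
      using PiE by simp
    finally show "emeasure ?D (Pi\<^sub>E I A) = emeasure ?E (Pi\<^sub>E I A)"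
      by (simp add: D.emeasure_eq_measure E.emeasure_eq_measure)
  next
    show "range (\<lambda>_. space ?P) \<subseteq> prod_algebra I (\<lambda>_. borel)"
      using I by (auto simp: space_PiM intro!: prod_algebraI_finite)
  qed (use I in auto)
qed

text \<open>Kac's criterion for independence: the joint law and the product of the marginals have the same
  characteristic function.\<close>

lemma (in prob_space) indep_var_if_char_product:
  fixes X Y :: "'a \<Rightarrow> real"
  assumes [measurable]: "X \<in> borel_measurable M" "Y \<in> borel_measurable M"
    and eq: "\<And>s t. (CLINT x|M. iexp (s * X x + t * Y x)) = (CLINT x|M. iexp (s * X x)) * (CLINT x|M. iexp (t * Y x))"
  shows "indep_var borel X borel Y"
proof -
  interpret X: real_distribution "distr M borel X" by (rule real_distribution_distr) simp
  interpret Y: real_distribution "distr M borel Y" by (rule real_distribution_distr) simp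
  let ?N = "distr M borel X \<Otimes>\<^sub>M distr M borel Y"
  interpret N: pair_prob_space "distr M borel X" "distr M borel Y" ..
  \<comment> \<open>A pair is a vector indexed by \<open>bool\<close>.\<close>
  let ?P = "PiM UNIV (\<lambda>_::bool. borel :: real measure)"
  have "distr M ?P (\<lambda>x. \<lambda>i\<in>UNIV. (if i then X x else Y x)) = distr ?N ?P (\<lambda>p. \<lambda>i\<in>UNIV. if i then fst p else snd p)"
  proof (rule Cramer_Wold)
    fix b :: "bool \<Rightarrow> real"
    have int: "integrable ?N (\<lambda>p. iexp (b True * fst p) * iexp (b False * snd p))"
      by (rule N.P.integrable_const_bound[of _ 1]) (auto simp: norm_mult)
    have "(CLINT p|?N. iexp (b True * fst p) * iexp (b False * snd p)) =
       (CLINT x|distr M borel X. CLINT y|distr M borel Y. iexp (b True * x) * iexp (b False * y))"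
      using N.integral_fst'[OF int] by simp
    also have "\<dots> = (CLINT x|M. iexp (b True * X x)) * (CLINT x|M. iexp (b False * Y x))"
      by (simp add: integral_distr)
    finally show "(CLINT x|M. iexp (\<Sum>i\<in>UNIV. b i * (if i then X x else Y x))) =
        (CLINT p|?N. iexp (\<Sum>i\<in>UNIV. b i * (if i then fst p else snd p)))"
      using eq[of "b True" "b False"] by (simp add: UNIV_bool ring_distribs exp_add add.commute mult.commute)
  qed (auto intro: finite_measure_axioms N.P.finite_measure_axioms)
  then have "distr (distr M ?P (\<lambda>x. \<lambda>i\<in>UNIV. (if i then X x else Y x))) (borel \<Otimes>\<^sub>M borel) (\<lambda>z. (z True, z False)) =
      distr (distr ?N ?P (\<lambda>p. \<lambda>i\<in>UNIV. if i then fst p else snd p)) (borel \<Otimes>\<^sub>M borel) (\<lambda>z. (z True, z False))"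
    by simp
  then have "distr M (borel \<Otimes>\<^sub>M borel) (\<lambda>x. (X x, Y x)) = distr ?N (borel \<Otimes>\<^sub>M borel) (\<lambda>p. p)"
    by (subst (asm) (1 2) distr_distr) (auto simp: comp_def)
  also have "\<dots> = ?N"
    by (intro distr_id2) (simp cong: sets_pair_measure_cong)
  finally show ?thesis
    unfolding indep_var_distribution_eq by simp
qed

section \<open>Gaussian vectors\<close>

text \<open>The quadratic form of \<open>R\<close>, that is, the variance of the linear combination with coefficients \<open>a\<close> of
  a vector with covariance \<open>R\<close>.\<close>

definition quad_form :: "'i set \<Rightarrow> ('i \<Rightarrow> 'i \<Rightarrow> real) \<Rightarrow> ('i \<Rightarrow> real) \<Rightarrow> real" where
  "quad_form I R a = (\<Sum>i\<in>I. \<Sum>j\<in>I. a i * a j * R i j)"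

lemma quad_form_scale: "quad_form I R (\<lambda>i. t * a i) = t\<^sup>2 * quad_form I R a"
  by (simp add: quad_form_def sum_distrib_left power2_eq_square mult_ac)

lemma quad_form_shift:
  assumes I: "finite I" "k \<in> I" and sym: "\<And>i j. i \<in> I \<Longrightarrow> j \<in> I \<Longrightarrow> R i j = R j i"
  shows "quad_form I R (\<lambda>i. s * a i + (if i = k then u else 0)) =
    s\<^sup>2 * quad_form I R a + 2 * s * u * (\<Sum>i\<in>I. a i * R i k) + u\<^sup>2 * R k k"
proof -
  let ?d = "\<lambda>i. if i = k then u else 0"
  have d: "(\<Sum>i\<in>I. (s * a i + ?d i) * f i) = s * (\<Sum>i\<in>I. a i * f i) + u * f k" for f
    using I by (simp add: ring_distribs sum.distrib sum_distrib_left mult_ac if_distrib[of "\<lambda>u. u * _"] if_distrib[of "\<lambda>u. _ * u"] cong: if_cong)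
  have q: "quad_form I R b = (\<Sum>i\<in>I. b i * (\<Sum>j\<in>I. b j * R i j))" for b
    by (simp add: quad_form_def sum_distrib_left mult_ac)
  have "(\<Sum>i\<in>I. a i * R k i) = (\<Sum>i\<in>I. a i * R i k)"
    using sym I by (intro sum.cong) auto
  then show ?thesis
    unfolding q d
    by (simp add: ring_distribs sum.distrib sum_distrib_left power2_eq_square mult_ac)
qed

lemma sum_shift:
  assumes "finite I" "k \<in> I"
  shows "(\<Sum>i\<in>I. (s * a i + (if i = k then u else 0)) * z i) = s * (\<Sum>i\<in>I. a i * z i) + u * (z k :: real)"
  using assms by (simp add: ring_distribs sum.distrib sum_distrib_left mult_ac if_distrib[of "\<lambda>u. u * _"] if_distrib[of "\<lambda>u. _ * u"] cong: if_cong)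

lemma centered_gaussianD:
  assumes "centered_gaussian M I X R"
  shows "prob_space M" "finite I" "\<And>i. i \<in> I \<Longrightarrow> X i \<in> borel_measurable M"
    "\<And>i j. i \<in> I \<Longrightarrow> j \<in> I \<Longrightarrow> R i j = R j i" "\<And>a. 0 \<le> quad_form I R a"
    "\<And>a. distr M borel (\<lambda>\<omega>. \<Sum>i\<in>I. a i * X i \<omega>) = normal_law 0 (quad_form I R a)"
  using assms unfolding centered_gaussian_def psd_matrix_on_def quad_form_def by blast+

lemma char_centered_gaussian:
  assumes G: "centered_gaussian M I X R"
  shows "(CLINT \<omega>|M. iexp (\<Sum>i\<in>I. a i * X i \<omega>)) = complex_of_real (exp (- quad_form I R a / 2))"
proof -
  note [measurable] = centered_gaussianD(3)[OF G]
  have "(CLINT \<omega>|M. iexp (\<Sum>i\<in>I. a i * X i \<omega>)) = char (distr M borel (\<lambda>\<omega>. \<Sum>i\<in>I. a i * X i \<omega>)) 1"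
    by (simp add: char_def integral_distr)
  then show ?thesis
    unfolding centered_gaussianD(6)[OF G] char_normal_law[OF centered_gaussianD(5)[OF G]] by simp
qed

text \<open>A vector is Gaussian as soon as its characteristic function is the Gaussian one.\<close>

lemma centered_gaussianI:
  assumes M: "prob_space M" and I: "finite I" and [measurable]: "\<And>i. i \<in> I \<Longrightarrow> X i \<in> borel_measurable M"
    and sym: "\<And>i j. i \<in> I \<Longrightarrow> j \<in> I \<Longrightarrow> R i j = R j i" and psd: "\<And>a. 0 \<le> quad_form I R a"
    and char: "\<And>a. (CLINT \<omega>|M. iexp (\<Sum>i\<in>I. a i * X i \<omega>)) = complex_of_real (exp (- quad_form I R a / 2))"
  shows "centered_gaussian M I X R"
proof -
  interpret prob_space M by fact
  have "distr M borel (\<lambda>\<omega>. \<Sum>i\<in>I. a i * X i \<omega>) = normal_law 0 (quad_form I R a)" for a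
  proof (rule Levy_uniqueness)
    show "char (distr M borel (\<lambda>\<omega>. \<Sum>i\<in>I. a i * X i \<omega>)) = char (normal_law 0 (quad_form I R a))"
    proof
      fix t
      have "char (distr M borel (\<lambda>\<omega>. \<Sum>i\<in>I. a i * X i \<omega>)) t = (CLINT \<omega>|M. iexp (\<Sum>i\<in>I. (t * a i) * X i \<omega>))"
        by (simp add: char_def integral_distr sum_distrib_left mult_ac)
      also have "\<dots> = char (normal_law 0 (quad_form I R a)) t"
        unfolding char char_normal_law[OF psd] quad_form_scale by simp
      finally show "char (distr M borel (\<lambda>\<omega>. \<Sum>i\<in>I. a i * X i \<omega>)) t = char (normal_law 0 (quad_form I R a)) t" .
    qed
  qed (auto intro!: real_distribution_distr real_distribution_normal_law psd)
  with assms show ?thesis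
    unfolding centered_gaussian_def psd_matrix_on_def quad_form_def by auto
qed

text \<open>The definite description in \<open>mvn_law\<close> is resolved by any Gaussian vector with the given covariance:
  existence is the law of that vector, uniqueness is the Cramer-Wold theorem.\<close>

lemma mvn_law_eq_distr:
  assumes G: "centered_gaussian M I X R"
  shows "mvn_law I R = distr M (PiM I (\<lambda>_. borel)) (\<lambda>\<omega>. \<lambda>i\<in>I. X i \<omega>)"
  unfolding mvn_law_def
proof (rule the_equality)
  interpret prob_space M by (rule centered_gaussianD[OF G])
  note [measurable] = centered_gaussianD(3)[OF G]
  let ?P = "PiM I (\<lambda>_. borel :: real measure)"
  let ?D = "distr M ?P (\<lambda>\<omega>. \<lambda>i\<in>I. X i \<omega>)"
  have "centered_gaussian ?D I (\<lambda>i y. y i) R"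
  proof (rule centered_gaussianI)
    fix a
    have "(CLINT y|?D. iexp (\<Sum>i\<in>I. a i * y i)) = (CLINT \<omega>|M. iexp (\<Sum>i\<in>I. a i * X i \<omega>))"
      by (simp add: integral_distr)
    then show "(CLINT y|?D. iexp (\<Sum>i\<in>I. a i * y i)) = complex_of_real (exp (- quad_form I R a / 2))"
      using char_centered_gaussian[OF G] by simp
  qed (use centered_gaussianD[OF G] in \<open>auto intro!: prob_space_distr\<close>)
  then show "sets ?D = sets ?P \<and> centered_gaussian ?D I (\<lambda>i y. y i) R"
    by simp
  fix N assume "sets N = sets ?P \<and> centered_gaussian N I (\<lambda>i y. y i) R"
  then have N: "sets N = sets ?P" and GN: "centered_gaussian N I (\<lambda>i y. y i) R" by auto
  have "N = distr N ?P (\<lambda>y. y)"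
    using N by (simp add: distr_id2)
  also have "\<dots> = distr N ?P (\<lambda>y. \<lambda>i\<in>I. y i)"
    using sets_eq_imp_space_eq[OF N] by (intro distr_cong) (auto simp: space_PiM PiE_def extensional_restrict)
  also have "\<dots> = ?D"
  proof (rule Cramer_Wold)
    show "finite_measure N"
      using centered_gaussianD(1)[OF GN] by (rule prob_space.finite_measure)
    show "(CLINT y|N. iexp (\<Sum>i\<in>I. b i * y i)) = (CLINT \<omega>|M. iexp (\<Sum>i\<in>I. b i * X i \<omega>))" for b
      unfolding char_centered_gaussian[OF G] char_centered_gaussian[OF GN] ..
  qed (use centered_gaussianD[OF G] centered_gaussianD[OF GN] finite_measure_axioms in auto)
  finally show "N = ?D" .
qed

lemma Phi_eq_prob:
  assumes G: "centered_gaussian M I X R"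
  shows "Phi I q R = measure M {\<omega> \<in> space M. \<forall>i\<in>I. X i \<omega> \<le> q i}"
proof (cases "I = {}")
  case True
  interpret prob_space M by (rule centered_gaussianD[OF G])
  show ?thesis
    using True by (simp add: Phi_def prob_space)
next
  case False
  note [measurable] = centered_gaussianD(3)[OF G]
  have [simp]: "finite I" by (rule centered_gaussianD[OF G])
  let ?P = "PiM I (\<lambda>_. borel :: real measure)"
  have "{y \<in> space ?P. \<forall>i\<in>I. y i \<le> q i} \<in> sets ?P"
    by measurable
  then show ?thesis
    using False unfolding Phi_def mvn_law_eq_distr[OF G]
    by (auto simp: measure_distr space_PiM intro!: arg_cong[of _ _ "measure M"])
qed

lemma centered_gaussian_linear_image:
  assumes G: "centered_gaussian M I X R" and J: "finite J"
  shows "centered_gaussian M J (\<lambda>j \<omega>. \<Sum>i\<in>I. A j i * X i \<omega>) (\<lambda>j l. \<Sum>i\<in>I. \<Sum>i'\<in>I. A j i * A l i' * R i i')"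
    (is "centered_gaussian M J ?Y ?Q")
proof (rule centered_gaussianI)
  note [measurable] = centered_gaussianD(3)[OF G]
  have q: "quad_form J ?Q a = quad_form I R (\<lambda>i. \<Sum>j\<in>J. a j * A j i)" for a
  proof -
    let ?T = "\<lambda>j l i i'. (a j * A j i) * (a l * A l i') * R i i'"
    have "quad_form J ?Q a = (\<Sum>j\<in>J. \<Sum>l\<in>J. \<Sum>i\<in>I. \<Sum>i'\<in>I. ?T j l i i')"
      by (simp add: quad_form_def sum_distrib_left mult_ac)
    also have "\<dots> = (\<Sum>j\<in>J. \<Sum>i\<in>I. \<Sum>l\<in>J. \<Sum>i'\<in>I. ?T j l i i')"
      by (rule sum.cong[OF refl], rule sum.swap)
    also have "\<dots> = (\<Sum>i\<in>I. \<Sum>j\<in>J. \<Sum>l\<in>J. \<Sum>i'\<in>I. ?T j l i i')"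
      by (rule sum.swap)
    also have "\<dots> = (\<Sum>i\<in>I. \<Sum>j\<in>J. \<Sum>i'\<in>I. \<Sum>l\<in>J. ?T j l i i')"
      by (rule sum.cong[OF refl], rule sum.cong[OF refl], rule sum.swap)
    also have "\<dots> = (\<Sum>i\<in>I. \<Sum>i'\<in>I. \<Sum>j\<in>J. \<Sum>l\<in>J. ?T j l i i')"
      by (rule sum.cong[OF refl], rule sum.swap)
    also have "\<dots> = quad_form I R (\<lambda>i. \<Sum>j\<in>J. a j * A j i)"
      unfolding quad_form_def sum_product by (simp only: sum_distrib_right)
    finally show ?thesis .
  qed
  show "0 \<le> quad_form J ?Q a" for a
    unfolding q by (rule centered_gaussianD[OF G])
  show "(CLINT \<omega>|M. iexp (\<Sum>j\<in>J. a j * ?Y j \<omega>)) = complex_of_real (exp (- quad_form J ?Q a / 2))" for a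
  proof -
    have "(\<Sum>j\<in>J. a j * ?Y j \<omega>) = (\<Sum>i\<in>I. (\<Sum>j\<in>J. a j * A j i) * X i \<omega>)" for \<omega>
      unfolding sum_distrib_left sum_distrib_right by (subst sum.swap) (simp add: mult_ac)
    then show ?thesis
      by (simp only: char_centered_gaussian[OF G] q)
  qed
  show "?Q j l = ?Q l j" if "j \<in> J" "l \<in> J" for j l
  proof -
    have "?Q j l = (\<Sum>i'\<in>I. \<Sum>i\<in>I. A j i * A l i' * R i i')"
      by (rule sum.swap)
    also have "\<dots> = ?Q l j"
      using centered_gaussianD(4)[OF G] by (intro sum.cong) auto
    finally show ?thesis .
  qed
qed (use J centered_gaussianD[OF G] in auto)

lemma centered_gaussian_component:
  assumes G: "centered_gaussian M I X R" and k: "k \<in> I"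
  shows "distr M borel (X k) = normal_law 0 (R k k)" "0 \<le> R k k"
proof -
  note GD = centered_gaussianD[OF G]
  have q: "quad_form I R (\<lambda>i. 0 * 0 + (if i = k then 1 else 0)) = R k k"
    by (subst quad_form_shift) (use GD k in auto)
  have "(\<Sum>i\<in>I. (0 * 0 + (if i = k then 1 else 0)) * X i \<omega>) = X k \<omega>" for \<omega>
    by (subst sum_shift) (use GD k in auto)
  then show "distr M borel (X k) = normal_law 0 (R k k)" "0 \<le> R k k"
    using GD(6)[of "\<lambda>i. 0 * 0 + (if i = k then 1 else 0)"] GD(5)[of "\<lambda>i. 0 * 0 + (if i = k then 1 else 0)"]
    unfolding q by simp_all
qed

text \<open>Linear regression of \<open>L = \<Sum> a\<^sub>i X\<^sub>i\<close> on \<open>X\<^sub>k\<close>: the residual \<open>L - \<alpha> X\<^sub>k\<close> is independent of \<open>X\<^sub>k\<close> and Gaussian. A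
  coefficient \<open>\<alpha>\<close> exists also when \<open>X\<^sub>k\<close> has variance zero.\<close>

lemma centered_gaussian_regression:
  assumes G: "centered_gaussian M I X R" and k: "k \<in> I"
  obtains \<alpha> where "(\<Sum>i\<in>I. a i * R i k) = \<alpha> * R k k"
    "prob_space.indep_var M borel (\<lambda>\<omega>. (\<Sum>i\<in>I. a i * X i \<omega>) - \<alpha> * X k \<omega>) borel (X k)"
    "(CLINT \<omega>|M. iexp ((\<Sum>i\<in>I. a i * X i \<omega>) - \<alpha> * X k \<omega>)) =
      complex_of_real (exp (- (quad_form I R a - \<alpha>\<^sup>2 * R k k) / 2))"
proof -
  note GD = centered_gaussianD[OF G]
  interpret prob_space M by (rule GD)
  note [measurable] = GD(3)
  let ?c = "\<Sum>i\<in>I. a i * R i k"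
  have Q: "quad_form I R (\<lambda>i. s * a i + (if i = k then u else 0)) =
      s\<^sup>2 * quad_form I R a + 2 * s * u * ?c + u\<^sup>2 * R k k" for s u
    by (rule quad_form_shift) (use GD k in auto)
  \<comment> \<open>In the degenerate case the covariance vanishes as well, because otherwise the form would be affine
    and non-constant along the \<open>k\<close>-th direction, hence negative somewhere.\<close>
  have "?c = 0" if "R k k = 0"
  proof (rule ccontr)
    assume c: "?c \<noteq> 0"
    have "0 \<le> quad_form I R a + 2 * (- (quad_form I R a + 1) / (2 * ?c)) * ?c"
      using GD(5)[of "\<lambda>i. 1 * a i + (if i = k then - (quad_form I R a + 1) / (2 * ?c) else 0)"]
      unfolding Q using that by simp
    then show False
      using c by (simp add: field_simps)
  qed
  then obtain \<alpha> where \<alpha>: "?c = \<alpha> * R k k"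
    by (metis mult_zero_right nonzero_divide_eq_eq)
  have char: "(CLINT \<omega>|M. iexp (s * ((\<Sum>i\<in>I. a i * X i \<omega>) - \<alpha> * X k \<omega>) + t * X k \<omega>)) =
      complex_of_real (exp (- (s\<^sup>2 * (quad_form I R a - \<alpha>\<^sup>2 * R k k)) / 2) * exp (- (t\<^sup>2 * R k k) / 2))" for s t
  proof -
    have "s * ((\<Sum>i\<in>I. a i * X i \<omega>) - \<alpha> * X k \<omega>) + t * X k \<omega> =
        (\<Sum>i\<in>I. (s * a i + (if i = k then t - s * \<alpha> else 0)) * X i \<omega>)" for \<omega>
      by (subst sum_shift) (use GD k in \<open>auto simp: algebra_simps\<close>)
    then show ?thesis
      unfolding exp_add[symmetric]
      by (simp only: char_centered_gaussian[OF G] Q \<alpha>) (simp add: power2_eq_square field_simps)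
  qed
  have "indep_var borel (\<lambda>\<omega>. (\<Sum>i\<in>I. a i * X i \<omega>) - \<alpha> * X k \<omega>) borel (X k)"
  proof (rule indep_var_if_char_product)
    fix s t
    show "(CLINT \<omega>|M. iexp (s * ((\<Sum>i\<in>I. a i * X i \<omega>) - \<alpha> * X k \<omega>) + t * X k \<omega>)) =
      (CLINT \<omega>|M. iexp (s * ((\<Sum>i\<in>I. a i * X i \<omega>) - \<alpha> * X k \<omega>))) * (CLINT \<omega>|M. iexp (t * X k \<omega>))"
      using char[of s t] char[of s 0] char[of 0 t] by simp
  qed (use k in measurable)
  from that[OF \<alpha> this] show ?thesis
    using char[of 1 0] by simp
qed

text \<open>The measure with density \<open>exp (X - v / 2)\<close>; it is a probability measure when \<open>X\<close> has law \<open>N(0, v)\<close>.\<close>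

definition tilted :: "'a measure \<Rightarrow> ('a \<Rightarrow> real) \<Rightarrow> real \<Rightarrow> 'a measure" where
  "tilted M X v = density M (\<lambda>\<omega>. ennreal (exp (X \<omega> - v / 2)))"

lemma
  assumes [measurable]: "X \<in> borel_measurable M" and X: "distr M borel X = normal_law 0 v" and v: "0 \<le> v"
  shows prob_space_tilted: "prob_space (tilted M X v)"
    and integrable_exp_normal: "integrable M (\<lambda>\<omega>. exp (X \<omega> - v / 2))"
    and distr_tilted: "distr (tilted M X v) borel X = normal_law v v"
proof -
  show D: "distr (tilted M X v) borel X = normal_law v v"
    using density_exp_normal_law[OF v] by (simp add: tilted_def X[symmetric] density_distr)
  interpret real_distribution "normal_law v v"
    using v by (rule real_distribution_normal_law)
  show "prob_space (tilted M X v)"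
  proof (rule prob_space_distrD)
    show "prob_space (distr (tilted M X v) borel X)"
      unfolding D by (rule prob_space_axioms)
  qed (simp add: tilted_def)
  then interpret T: prob_space "tilted M X v" .
  have "(\<integral>\<^sup>+\<omega>. ennreal (exp (X \<omega> - v / 2)) \<partial>M) = 1"
    using T.emeasure_space_1 by (simp add: tilted_def emeasure_density cong: nn_integral_cong_simp)
  then show "integrable M (\<lambda>\<omega>. exp (X \<omega> - v / 2))"
    by (intro integrableI_nonneg) auto
qed

text \<open>The Cameron-Martin formula: under the measure tilted by \<open>X\<^sub>k\<close> the vector keeps its covariance and its
  mean becomes the \<open>k\<close>-th column of \<open>R\<close>. By regression on \<open>X\<^sub>k\<close> only \<open>X\<^sub>k\<close> itself feels the tilt.\<close>

lemma centered_gaussian_tilted: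
  assumes G: "centered_gaussian M I X R" and k: "k \<in> I"
  shows "centered_gaussian (tilted M (X k) (R k k)) I (\<lambda>i \<omega>. X i \<omega> - R i k) R"
proof (rule centered_gaussianI)
  note GD = centered_gaussianD[OF G]
  note [measurable] = GD(3)
  note Xk = centered_gaussian_component[OF G k]
  have [measurable]: "X k \<in> borel_measurable M" using k by simp
  let ?Q = "tilted M (X k) (R k k)"
  show "prob_space ?Q"
    by (rule prob_space_tilted) (use Xk in auto)
  interpret prob_space M by (rule GD)
  fix a
  let ?L = "\<lambda>\<omega>. \<Sum>i\<in>I. a i * X i \<omega>"
  obtain \<alpha> where \<alpha>: "(\<Sum>i\<in>I. a i * R i k) = \<alpha> * R k k"
    and indep: "indep_var borel (\<lambda>\<omega>. ?L \<omega> - \<alpha> * X k \<omega>) borel (X k)"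
    and char: "(CLINT \<omega>|M. iexp (?L \<omega> - \<alpha> * X k \<omega>)) =
      complex_of_real (exp (- (quad_form I R a - \<alpha>\<^sup>2 * R k k) / 2))"
    using centered_gaussian_regression[OF G k] by blast
  let ?g = "\<lambda>\<omega>. exp (X k \<omega> - R k k / 2) *\<^sub>R iexp (\<alpha> * X k \<omega>)"
  have int: "integrable M ?g"
    by (rule Bochner_Integration.integrable_bound[OF integrable_exp_normal[OF _ Xk]]) (auto simp: norm_mult)
  have "(CLINT \<omega>|M. ?g \<omega>) = (CLINT \<omega>|?Q. iexp (\<alpha> * X k \<omega>))"
    by (simp add: tilted_def integral_density)
  also have "\<dots> = char (distr ?Q borel (X k)) \<alpha>"
    by (simp add: char_def integral_distr tilted_def)
  also have "\<dots> = iexp (\<alpha> * R k k) * exp (- (\<alpha>\<^sup>2 * R k k / 2))"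
    using distr_tilted[OF _ Xk] Xk by (simp add: char_normal_law)
  finally have g: "(CLINT \<omega>|M. ?g \<omega>) = iexp (\<alpha> * R k k) * exp (- (\<alpha>\<^sup>2 * R k k / 2))" .
  have "(CLINT \<omega>|?Q. iexp (\<Sum>i\<in>I. a i * (X i \<omega> - R i k))) =
      (CLINT \<omega>|M. exp (X k \<omega> - R k k / 2) *\<^sub>R iexp (?L \<omega> - \<alpha> * R k k))"
    using \<alpha> by (simp add: tilted_def integral_density right_diff_distrib sum_subtractf)
  also have "\<dots> = (CLINT \<omega>|M. iexp (- \<alpha> * R k k) * (iexp (?L \<omega> - \<alpha> * X k \<omega>) * ?g \<omega>))"
    by (intro Bochner_Integration.integral_cong refl)
      (simp add: scaleR_conv_of_real exp_of_real[symmetric] exp_add[symmetric] algebra_simps)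
  also have "\<dots> = iexp (- \<alpha> * R k k) * ((CLINT \<omega>|M. iexp (?L \<omega> - \<alpha> * X k \<omega>)) * (CLINT \<omega>|M. ?g \<omega>))"
  proof -
    have "indep_var borel (iexp \<circ> (\<lambda>\<omega>. ?L \<omega> - \<alpha> * X k \<omega>)) borel ((\<lambda>x. exp (x - R k k / 2) *\<^sub>R iexp (\<alpha> * x)) \<circ> X k)"
      by (rule indep_var_compose[OF indep]) auto
    moreover have "integrable M (\<lambda>\<omega>. iexp (?L \<omega> - \<alpha> * X k \<omega>))"
      by (auto intro!: integrable_iexp)
    ultimately have "(CLINT \<omega>|M. iexp (?L \<omega> - \<alpha> * X k \<omega>) * ?g \<omega>) = (CLINT \<omega>|M. iexp (?L \<omega> - \<alpha> * X k \<omega>)) * (CLINT \<omega>|M. ?g \<omega>)"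
      unfolding comp_def by (rule indep_var_lebesgue_integral[OF _ _ int])
    then show ?thesis by (simp only: integral_mult_right_zero)
  qed
  also have "\<dots> = complex_of_real (exp (- quad_form I R a / 2))"
    unfolding g char
    by (simp add: exp_of_real[symmetric] exp_add[symmetric] algebra_simps diff_divide_distrib add_divide_distrib)
  finally show "(CLINT \<omega>|?Q. iexp (\<Sum>i\<in>I. a i * (X i \<omega> - R i k))) = complex_of_real (exp (- quad_form I R a / 2))" .
qed (use centered_gaussianD[OF G] in \<open>auto simp: tilted_def\<close>)

section \<open>The exponent function as a sum of normal probabilities\<close>

context
  fixes M :: "'a measure" and U :: "'a \<Rightarrow> real^'n" and S :: "real^'n^'n"
  assumes G: "centered_gaussian M UNIV (\<lambda>i \<omega>. U \<omega> $ i) (\<lambda>i j. S $ i $ j)"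
begin

interpretation prob_space M
  by (rule centered_gaussianD(1)[OF G])

lemma measurable_component[measurable]: "(\<lambda>\<omega>. U \<omega> $ i) \<in> borel_measurable M"
  using centered_gaussianD(3)[OF G, of i] by simp

lemma measurable_HR_Z[measurable]: "HR_Z S U i \<in> borel_measurable M"
  unfolding HR_Z_def by measurable

lemma Max_HR_Z_measurable[measurable]:
  "(\<lambda>\<omega>. Max (range (\<lambda>i. HR_Z S U i \<omega> / x $ i))) \<in> borel_measurable M"
  by (rule borel_measurable_Max) auto

lemma component_sym: "S $ i $ j = S $ j $ i"
  using centered_gaussianD(4)[OF G] by simp

lemma distr_component_diff:
  shows "distr M borel (\<lambda>\<omega>. U \<omega> $ i - U \<omega> $ j) = normal_law 0 (S $ i $ i + S $ j $ j - 2 * S $ i $ j)"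
    and "0 \<le> S $ i $ i + S $ j $ j - 2 * S $ i $ j"
proof -
  let ?e = "\<lambda>l. 0 * 0 + (if l = i then 1 else 0)" and ?R = "\<lambda>i j. S $ i $ j"
  let ?a = "\<lambda>l. 1 * ?e l + (if l = j then -1 else 0)"
  have "(\<Sum>l\<in>UNIV. ?e l * S $ l $ j) = S $ i $ j"
    by (subst sum_shift) auto
  moreover have "quad_form UNIV ?R ?e = S $ i $ i"
    by (subst quad_form_shift) (auto simp: component_sym)
  ultimately have q: "quad_form UNIV ?R ?a = S $ i $ i + S $ j $ j - 2 * S $ i $ j"
    by (subst quad_form_shift) (auto simp: component_sym)
  have "(\<Sum>l\<in>UNIV. ?a l * U \<omega> $ l) = U \<omega> $ i - U \<omega> $ j" for \<omega>
    by (subst sum_shift, simp, simp, subst sum_shift) auto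
  then show "distr M borel (\<lambda>\<omega>. U \<omega> $ i - U \<omega> $ j) = normal_law 0 (S $ i $ i + S $ j $ j - 2 * S $ i $ j)"
    and "0 \<le> S $ i $ i + S $ j $ j - 2 * S $ i $ j"
    using centered_gaussianD(5,6)[OF G, of ?a] unfolding q by simp_all
qed

lemma HR_gamma_eq: "HR_gamma M U i j = S $ i $ i + S $ j $ j - 2 * S $ i $ j"
proof -
  let ?v = "S $ i $ i + S $ j $ j - 2 * S $ i $ j"
  note D = distr_component_diff[of i j]
  have "expectation (\<lambda>\<omega>. U \<omega> $ i - U \<omega> $ j) = (\<integral>x. x \<partial>distr M borel (\<lambda>\<omega>. U \<omega> $ i - U \<omega> $ j))"
    by (subst integral_distr) auto
  then have "expectation (\<lambda>\<omega>. U \<omega> $ i - U \<omega> $ j) = 0"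
    using integral_normal_law_first[OF D(2)] unfolding D(1) by simp
  then have "HR_gamma M U i j = expectation (\<lambda>\<omega>. (U \<omega> $ i - U \<omega> $ j)\<^sup>2)"
    by (simp add: HR_gamma_def)
  also have "\<dots> = (\<integral>x. x\<^sup>2 \<partial>distr M borel (\<lambda>\<omega>. U \<omega> $ i - U \<omega> $ j))"
    by (subst integral_distr) auto
  also have "\<dots> = ?v"
    unfolding D(1) by (rule integral_normal_law_second[OF D(2)])
  finally show ?thesis .
qed

lemma HR_lambda_square: "(HR_lambda M U i j)\<^sup>2 = S $ i $ i + S $ j $ j - 2 * S $ i $ j"
  using distr_component_diff(2) by (simp add: HR_lambda_def HR_gamma_eq)

lemma component_law:
  "distr M borel (\<lambda>\<omega>. U \<omega> $ k) = normal_law 0 (S $ k $ k)" "0 \<le> S $ k $ k"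
  using centered_gaussian_component[OF G, of k] by simp_all

lemma integrable_HR_Z: "integrable M (HR_Z S U k)"
  using integrable_exp_normal[OF _ component_law, of k] unfolding HR_Z_def by simp

text \<open>The probability measure with density \<open>HR_Z S U k\<close> with respect to \<open>M\<close>.\<close>

abbreviation "HR_tilted k \<equiv> tilted M (\<lambda>\<omega>. U \<omega> $ k) (S $ k $ k)"

lemma measure_HR_tilted:
  assumes "A \<in> sets M"
  shows "measure (HR_tilted k) A = expectation (\<lambda>\<omega>. HR_Z S U k \<omega> * indicator A \<omega>)"
proof -
  have "measure (HR_tilted k) A = (\<integral>\<omega>. indicator A \<omega> \<partial>HR_tilted k)"
    using assms by (simp add: tilted_def)
  also have "\<dots> = expectation (\<lambda>\<omega>. HR_Z S U k \<omega> * indicator A \<omega>)"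
    using assms unfolding tilted_def by (subst integral_density) (auto simp: HR_Z_def)
  finally show ?thesis .
qed

lemma expectation_HR_Z: "expectation (HR_Z S U k) = 1"
proof -
  interpret T: prob_space "HR_tilted k"
    by (rule prob_space_tilted[OF _ component_law]) simp
  have "expectation (HR_Z S U k) = measure (HR_tilted k) (space M)"
    by (subst measure_HR_tilted) (auto intro!: Bochner_Integration.integral_cong)
  also have "\<dots> = 1"
    using T.prob_space by (simp add: tilted_def)
  finally show ?thesis .
qed

context
  assumes lambda_pos: "\<And>i j. i \<noteq> j \<Longrightarrow> HR_lambda M U i j > 0"
begin

text \<open>Under the measure tilted by \<open>U\<^sub>k\<close> the centred and normalized differences \<open>U\<^sub>j - U\<^sub>k\<close> have the correlation
  matrix \<open>HR_R\<close> based at \<open>k\<close>.\<close>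

lemma centered_gaussian_HR_differences:
  "centered_gaussian (HR_tilted k) (UNIV - {k})
    (\<lambda>j \<omega>. (U \<omega> $ j - U \<omega> $ k - (S $ j $ k - S $ k $ k)) / HR_lambda M U k j) (HR_R (HR_lambda M U) k)"
proof -
  let ?l = "HR_lambda M U"
  \<comment> \<open>The matrix that maps a vector to its normalized differences with the \<open>k\<close>-th component.\<close>
  let ?A = "\<lambda>j i. ((if i = j then 1 else 0) - (if i = k then 1 else 0)) / ?l k j"
  have A: "(\<Sum>i\<in>UNIV. ?A j i * z i) = (z j - z k) / ?l k j" for j and z :: "'n \<Rightarrow> real"
  proof -
    have "(\<Sum>i\<in>UNIV. ?A j i * z i) = (\<Sum>i\<in>UNIV. ((if i = j then z i else 0) - (if i = k then z i else 0)) / ?l k j)"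
      by (intro sum.cong) auto
    also have "\<dots> = (z j - z k) / ?l k j"
      unfolding sum_divide_distrib[symmetric] sum_subtractf by simp
    finally show ?thesis .
  qed
  have "centered_gaussian (HR_tilted k) UNIV (\<lambda>i \<omega>. U \<omega> $ i - S $ i $ k) (\<lambda>i j. S $ i $ j)"
    by (rule centered_gaussian_tilted[OF G]) simp
  from centered_gaussian_linear_image[OF this, of "UNIV - {k}" ?A]
  have 1: "centered_gaussian (HR_tilted k) (UNIV - {k})
      (\<lambda>j \<omega>. ((U \<omega> $ j - S $ j $ k) - (U \<omega> $ k - S $ k $ k)) / ?l k j)
      (\<lambda>j l. \<Sum>i\<in>UNIV. \<Sum>i'\<in>UNIV. ?A j i * ?A l i' * S $ i $ i')"
    unfolding A by simp
  have "(\<Sum>i\<in>UNIV. \<Sum>i'\<in>UNIV. ?A j i * ?A l i' * S $ i $ i') = HR_R ?l k j l" for j l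
  proof -
    have "(\<Sum>i\<in>UNIV. \<Sum>i'\<in>UNIV. ?A j i * ?A l i' * S $ i $ i') =
        (\<Sum>i\<in>UNIV. ?A j i * (\<Sum>i'\<in>UNIV. ?A l i' * S $ i $ i'))"
      by (simp only: sum_distrib_left mult.assoc)
    also have "\<dots> = ((S $ j $ l - S $ j $ k) / ?l k l - (S $ k $ l - S $ k $ k) / ?l k l) / ?l k j"
      unfolding A ..
    also have "\<dots> = (S $ j $ l - S $ j $ k - (S $ k $ l - S $ k $ k)) / (?l k j * ?l k l)"
      by (simp add: diff_divide_distrib mult.commute)
    also have "S $ j $ l - S $ j $ k - (S $ k $ l - S $ k $ k) = ((?l k j)\<^sup>2 + (?l k l)\<^sup>2 - (?l j l)\<^sup>2) / 2"
      unfolding HR_lambda_square using component_sym[of j k] by simp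
    finally show ?thesis
      by (simp add: HR_R_def mult.assoc)
  qed
  with 1 show ?thesis by (simp add: algebra_simps)
qed

text \<open>The threshold \<open>HR_q\<close> arises from \<open>S\<^sub>j\<^sub>j / 2 - S\<^sub>k\<^sub>k / 2 - (S\<^sub>j\<^sub>k - S\<^sub>k\<^sub>k) = \<lambda>\<^sup>2 / 2\<close>.\<close>

lemma HR_Z_le_iff:
  assumes x: "\<And>i. 0 < x $ i" and "j \<noteq> k"
  shows "HR_Z S U j \<omega> / x $ j \<le> HR_Z S U k \<omega> / x $ k \<longleftrightarrow>
    (U \<omega> $ j - U \<omega> $ k - (S $ j $ k - S $ k $ k)) / HR_lambda M U k j \<le> HR_q (HR_lambda M U) k x j"
proof -
  let ?l = "HR_lambda M U k j"
  have l: "0 < ?l" using lambda_pos assms by simp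
  have Z: "HR_Z S U i \<omega> / x $ i = exp (U \<omega> $ i - S $ i $ i / 2 - ln (x $ i))" for i
    using x by (simp add: HR_Z_def exp_diff)
  have "HR_Z S U j \<omega> / x $ j \<le> HR_Z S U k \<omega> / x $ k \<longleftrightarrow>
      U \<omega> $ j - U \<omega> $ k - (S $ j $ k - S $ k $ k) \<le> ?l\<^sup>2 / 2 + (ln (x $ j) - ln (x $ k))"
    unfolding Z exp_le_cancel_iff HR_lambda_square component_sym[of k j]
    by (rule iffI) (simp_all add: field_simps)
  also have "?l\<^sup>2 / 2 + (ln (x $ j) - ln (x $ k)) = HR_q (HR_lambda M U) k x j * ?l"
    using l x[of j] x[of k] by (simp add: HR_q_def power2_eq_square ln_div field_simps)
  finally show ?thesis
    using l by (simp add: pos_divide_le_eq)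
qed

lemma expectation_HR_Z_max:
  assumes x: "\<And>i. 0 < x $ i"
  shows "expectation (\<lambda>\<omega>. HR_Z S U k \<omega> * indicator {\<omega>\<in>space M. \<forall>j\<in>UNIV - {k}. HR_Z S U j \<omega> / x $ j \<le> HR_Z S U k \<omega> / x $ k} \<omega>) =
    Phi (UNIV - {k}) (HR_q (HR_lambda M U) k x) (HR_R (HR_lambda M U) k)"
proof -
  have "{\<omega>\<in>space M. \<forall>j\<in>UNIV - {k}. HR_Z S U j \<omega> / x $ j \<le> HR_Z S U k \<omega> / x $ k} \<in> sets M"
    by measurable
  from measure_HR_tilted[OF this, of k] show ?thesis
    unfolding Phi_eq_prob[OF centered_gaussian_HR_differences] tilted_def
    using HR_Z_le_iff[OF x] by (simp cong: conj_cong)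
qed

lemma AE_no_ties:
  assumes x: "\<And>i. 0 < x $ i"
  shows "AE \<omega> in M. \<forall>i j. i \<noteq> j \<longrightarrow> HR_Z S U i \<omega> / x $ i \<noteq> HR_Z S U j \<omega> / x $ j"
proof -
  have "AE \<omega> in M. i \<noteq> j \<longrightarrow> HR_Z S U i \<omega> / x $ i \<noteq> HR_Z S U j \<omega> / x $ j" for i j
  proof (cases "i = j")
    case False
    let ?c = "S $ i $ i / 2 + ln (x $ i) - (S $ j $ j / 2 + ln (x $ j))"
    have "0 < S $ i $ i + S $ j $ j - 2 * S $ i $ j"
      using lambda_pos[OF False] HR_lambda_square[of i j] by (metis zero_less_power)
    then have "AE y in distr M borel (\<lambda>\<omega>. U \<omega> $ i - U \<omega> $ j). y \<noteq> ?c"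
      unfolding distr_component_diff(1) by (rule AE_normal_law_neq)
    then have "AE \<omega> in M. U \<omega> $ i - U \<omega> $ j \<noteq> ?c"
      by (subst (asm) AE_distr_iff) auto
    then show ?thesis
    proof eventually_elim
      case (elim \<omega>)
      have "HR_Z S U i \<omega> / x $ i = exp (U \<omega> $ i - S $ i $ i / 2 - ln (x $ i))" for i
        using x by (simp add: HR_Z_def exp_diff)
      with elim show ?case by auto
    qed
  qed simp
  then show ?thesis
    by (simp add: AE_all_countable)
qed

text \<open>The maximum is split according to the index that attains it. That index is almost surely unique, and
  the \<open>k\<close>-th part is \<open>1 / x\<^sub>k\<close> times the probability, under the measure tilted by \<open>U\<^sub>k\<close>, that \<open>k\<close> attains the maximum.\<close>

lemma HR_V_eq_sum_Phi:
  assumes x: "\<And>i. 0 < x $ i"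
  shows "HR_V M S U x = (\<Sum>k\<in>UNIV. 1 / x $ k * Phi (UNIV - {k}) (HR_q (HR_lambda M U) k x) (HR_R (HR_lambda M U) k))"
proof -
  let ?A = "\<lambda>k. {\<omega>\<in>space M. \<forall>j\<in>UNIV - {k}. HR_Z S U j \<omega> / x $ j \<le> HR_Z S U k \<omega> / x $ k}"
  have [measurable]: "?A k \<in> sets M" for k by measurable
  have "AE \<omega> in M. Max (range (\<lambda>i. HR_Z S U i \<omega> / x $ i)) = (\<Sum>k\<in>UNIV. 1 / x $ k * (HR_Z S U k \<omega> * indicator (?A k) \<omega>))"
    using AE_no_ties[OF x] AE_space
  proof eventually_elim
    case (elim \<omega>)
    let ?z = "\<lambda>i. HR_Z S U i \<omega> / x $ i"
    have "Max (range ?z) \<in> range ?z" by (rule Max_in) auto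
    then obtain m where m: "Max (range ?z) = ?z m" by (rule rangeE)
    have le: "?z j \<le> ?z m" for j
      unfolding m[symmetric] by (rule Max_ge) auto
    have "indicator (?A k) \<omega> = (if k = m then 1 else 0 :: real)" for k
    proof (cases "k = m")
      case False
      have "?z k < ?z m"
        by (rule le_neq_trans[OF le]) (use elim(1) False in blast)
      moreover have "?z m \<le> ?z k" if "\<omega> \<in> ?A k"
        using that False by blast
      ultimately have "\<omega> \<notin> ?A k"
        by (meson not_le)
      then show ?thesis using False by simp
    next
      case True
      then have "\<omega> \<in> ?A k"
        using le elim(2) by blast
      then show ?thesis using True by simp
    qed
    then have "(\<Sum>k\<in>UNIV. 1 / x $ k * (HR_Z S U k \<omega> * indicator (?A k) \<omega>)) = (\<Sum>k\<in>UNIV. if k = m then ?z k else 0)"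
      by (intro sum.cong) auto
    also have "\<dots> = ?z m"
      by simp
    finally show ?case
      using m by simp
  qed
  then have "HR_V M S U x = expectation (\<lambda>\<omega>. \<Sum>k\<in>UNIV. 1 / x $ k * (HR_Z S U k \<omega> * indicator (?A k) \<omega>))"
    unfolding HR_V_def by (intro integral_cong_AE) auto
  also have "\<dots> = (\<Sum>k\<in>UNIV. expectation (\<lambda>\<omega>. 1 / x $ k * (HR_Z S U k \<omega> * indicator (?A k) \<omega>)))"
    by (intro Bochner_Integration.integral_sum integrable_mult_right integrable_real_mult_indicator integrable_HR_Z) auto
  also have "\<dots> = (\<Sum>k\<in>UNIV. 1 / x $ k * Phi (UNIV - {k}) (HR_q (HR_lambda M U) k x) (HR_R (HR_lambda M U) k))"
    unfolding expectation_HR_Z_max[OF x, symmetric] by simp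
  finally show ?thesis .
qed

end

lemma HR_V_bounds:
  assumes x: "\<And>i. 0 < x $ i"
  shows "1 / x $ k \<le> HR_V M S U x" "HR_V M S U x \<le> (\<Sum>i\<in>UNIV. 1 / x $ i)"
proof -
  let ?z = "\<lambda>\<omega> i. HR_Z S U i \<omega> / x $ i"
  have z: "0 \<le> ?z \<omega> i" for \<omega> i
    using x[of i] by (simp add: HR_Z_def)
  have ge: "?z \<omega> i \<le> Max (range (?z \<omega>))" for \<omega> i
    by (rule Max_ge) auto
  have le: "Max (range (?z \<omega>)) \<le> (\<Sum>i\<in>UNIV. ?z \<omega> i)" for \<omega>
    using z by (intro Max.boundedI) (auto intro!: member_le_sum)
  have int_z: "integrable M (\<lambda>\<omega>. ?z \<omega> i)" for i
    using integrable_HR_Z by simp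
  then have int_sum: "integrable M (\<lambda>\<omega>. \<Sum>i\<in>UNIV. ?z \<omega> i)"
    by simp
  have int_Max: "integrable M (\<lambda>\<omega>. Max (range (?z \<omega>)))"
  proof (rule Bochner_Integration.integrable_bound[OF int_sum])
    show "AE \<omega> in M. norm (Max (range (?z \<omega>))) \<le> norm (\<Sum>i\<in>UNIV. ?z \<omega> i)"
      using order_trans[OF z ge] le by (intro AE_I2) (simp add: abs_of_nonneg sum_nonneg z)
  qed simp
  have "1 / x $ k = expectation (\<lambda>\<omega>. ?z \<omega> k)"
    using expectation_HR_Z[of k] by simp
  also have "\<dots> \<le> HR_V M S U x"
    unfolding HR_V_def by (rule integral_mono[OF int_z int_Max ge])
  finally show "1 / x $ k \<le> HR_V M S U x" .
  have "HR_V M S U x \<le> expectation (\<lambda>\<omega>. \<Sum>i\<in>UNIV. ?z \<omega> i)"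
    unfolding HR_V_def by (rule integral_mono[OF int_Max int_sum le])
  also have "\<dots> = (\<Sum>i\<in>UNIV. 1 / x $ i)"
    using int_z expectation_HR_Z by simp
  finally show "HR_V M S U x \<le> (\<Sum>i\<in>UNIV. 1 / x $ i)" .
qed

end

lemma HR_V_scaleR:
  assumes "0 < r"
  shows "HR_V M S U (r *\<^sub>R x) = HR_V M S U x / r"
proof -
  have "Max (range (\<lambda>i. HR_Z S U i \<omega> / (r *\<^sub>R x) $ i)) = Max (range (\<lambda>i. HR_Z S U i \<omega> / x $ i)) / r" for \<omega>
  proof -
    have "mono (\<lambda>y. y / r)" using assms by (auto intro!: monoI divide_right_mono)
    from mono_Max_commute[OF this, of "range (\<lambda>i. HR_Z S U i \<omega> / x $ i)"] show ?thesis
      by (simp add: image_image mult.commute)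
  qed
  then show ?thesis
    by (simp add: HR_V_def)
qed

section \<open>The bound on the Kolmogorov distance\<close>

text \<open>The relative gap \<open>(b - a) / a\<close> enters \<open>omega\<close>; it is at most the absolute gap because \<open>a \<ge> 1\<close>.\<close>

lemma exp_diff_le_omega_scaled:
  assumes "1 \<le> a" "a \<le> b" "b - a \<le> t" "0 < r"
  shows "\<bar>exp (- (a / r)) - exp (- (b / r))\<bar> \<le> omega t"
proof -
  let ?s = "(b - a) / a"
  have "(1 + ?s) * (a / r) = b / r"
    using assms by (simp add: field_simps)
  moreover have "0 \<le> ?s" using assms by simp
  ultimately have "exp (- (a / r)) - exp (- (b / r)) \<le> omega ?s"
    using exp_diff_le_omega[of ?s "a / r"] by (simp only:)
  also have "?s \<le> (b - a) / 1"
    using assms by (intro divide_left_mono) auto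
  then have "omega ?s \<le> omega t"
    using assms by (intro omega_mono) auto
  finally show ?thesis
    using assms by (simp add: divide_right_mono)
qed

theorem mainTheorem11:
  fixes M1 :: "'a measure" and U1 :: "'a \<Rightarrow> real^'n" and S1 :: "real^'n^'n"
    and M2 :: "'b measure" and U2 :: "'b \<Rightarrow> real^'n" and S2 :: "real^'n^'n"
  assumes "centered_gaussian M1 UNIV (\<lambda>i \<omega>. U1 \<omega> $ i) (\<lambda>i j. S1 $ i $ j)"
    and "centered_gaussian M2 UNIV (\<lambda>i \<omega>. U2 \<omega> $ i) (\<lambda>i j. S2 $ i $ j)"
    and "\<And>i j. i \<noteq> j \<Longrightarrow> HR_lambda M1 U1 i j > 0"
    and "\<And>i j. i \<noteq> j \<Longrightarrow> HR_lambda M2 U2 i j > 0"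
  shows "kolmogorov_dist (HR_F M1 S1 U1) (HR_F M2 S2 U2)
           \<le> omega (Delta_HR (HR_lambda M1 U1) (HR_lambda M2 U2)) \<and>
         omega (Delta_HR (HR_lambda M1 U1) (HR_lambda M2 U2))
           \<le> Delta_HR (HR_lambda M1 U1) (HR_lambda M2 U2) / exp 1"
proof
  let ?D = "Delta_HR (HR_lambda M1 U1) (HR_lambda M2 U2)"
  let ?X = "{x :: real^'n. (\<forall>i. x $ i > 0) \<and> Min (range (\<lambda>i. x $ i)) = 1}"
  let ?V1 = "HR_V M1 S1 U1" and ?V2 = "HR_V M2 S2 U2"
  have D: "?D = (SUP x\<in>?X. \<bar>?V1 x - ?V2 x\<bar>)"
    unfolding Delta_HR_def
    using HR_V_eq_sum_Phi[OF assms(1,3)] HR_V_eq_sum_Phi[OF assms(2,4)]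
    by (intro SUP_cong refl) (simp add: right_diff_distrib sum_subtractf)
  have ge1: "1 \<le> ?V1 x" "1 \<le> ?V2 x" and card: "\<bar>?V1 x - ?V2 x\<bar> \<le> real CARD('n)" if "x \<in> ?X" for x
  proof -
    have x: "0 < x $ i" for i using that by simp
    have "Min (range (\<lambda>i. x $ i)) \<in> range (\<lambda>i. x $ i)" by (rule Min_in) auto
    then obtain k where "Min (range (\<lambda>i. x $ i)) = x $ k" by (rule rangeE)
    then have k: "x $ k = 1" using that by simp
    have "1 \<le> x $ i" for i
    proof -
      have "Min (range (\<lambda>i. x $ i)) \<le> x $ i" by (rule Min_le) auto
      then show ?thesis using that by (simp only: mem_Collect_eq)
    qed
    then have "(\<Sum>i\<in>UNIV. 1 / x $ i) \<le> (\<Sum>i\<in>(UNIV :: 'n set). 1)"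
      using x by (intro sum_mono) simp
    then have "?V1 x \<le> real CARD('n)" "?V2 x \<le> real CARD('n)"
      using HR_V_bounds(2)[OF assms(1) x] HR_V_bounds(2)[OF assms(2) x] by simp_all
    then show "1 \<le> ?V1 x" "1 \<le> ?V2 x" "\<bar>?V1 x - ?V2 x\<bar> \<le> real CARD('n)"
      using HR_V_bounds(1)[OF assms(1) x, of k] HR_V_bounds(1)[OF assms(2) x, of k] k by simp_all
  qed
  have upper: "\<bar>?V1 x - ?V2 x\<bar> \<le> ?D" if "x \<in> ?X" for x
    unfolding D using that card by (intro cSUP_upper) (auto intro!: bdd_aboveI2)
  \<comment> \<open>The index set is non-empty, so the supremum is nonnegative.\<close>
  have "(\<chi> i. 1) \<in> ?X" by simp
  from upper[OF this] have D0: "0 \<le> ?D" by linarith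
  show "omega ?D \<le> ?D / exp 1"
    using D0 by (rule omega_le_divide_exp1)
  have "\<bar>HR_F M1 S1 U1 x - HR_F M2 S2 U2 x\<bar> \<le> omega ?D" for x
  proof (cases "\<forall>i. x $ i > 0")
    case True
    \<comment> \<open>By homogeneity the point is moved to the normalized set, at the cost of dividing the exponents by \<open>r\<close>.\<close>
    define r where "r = Min (range (\<lambda>i. x $ i))"
    have "r \<in> range (\<lambda>i. x $ i)" unfolding r_def by (rule Min_in) auto
    then have r: "0 < r" using True by auto
    define y where "y = (1 / r) *\<^sub>R x"
    have xy: "x = r *\<^sub>R y" using r by (simp add: y_def)
    have "mono (\<lambda>z. z / r)" using r by (auto intro!: monoI divide_right_mono)
    from mono_Min_commute[OF this, of "range (\<lambda>i. x $ i)"]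
    have "Min (range (\<lambda>i. y $ i)) = 1"
      using r by (simp add: y_def image_image r_def[symmetric])
    then have y: "y \<in> ?X" using True r by (simp add: y_def)
    have F: "HR_F M1 S1 U1 x = exp (- (?V1 y / r))" "HR_F M2 S2 U2 x = exp (- (?V2 y / r))"
      using True r by (simp_all add: HR_F_def) (simp_all add: xy HR_V_scaleR)
    show ?thesis
    proof (cases "?V1 y \<le> ?V2 y")
      case True
      then show ?thesis
        unfolding F using ge1[OF y] upper[OF y] r by (intro exp_diff_le_omega_scaled) auto
    next
      case False
      then show ?thesis
        unfolding F using ge1[OF y] upper[OF y] r
        by (subst abs_minus_commute) (intro exp_diff_le_omega_scaled, auto)
    qed
  next
    case False
    then show ?thesis
      using omega_mono[OF order_refl D0] by (auto simp: HR_F_def omega_def)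
  qed
  then show "kolmogorov_dist (HR_F M1 S1 U1) (HR_F M2 S2 U2) \<le> omega ?D"
    unfolding kolmogorov_dist_def by (intro cSUP_least) auto
qed

end
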